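(* Let $k\ge 2$ be an integer. Then the set $\mathrm{Fix}(\mathcal{B}_k)=\{\alpha\in\mathbf{C}^2:\mathcal{B}_k(\alpha)=\alpha\}$ has exactly $k^2$ elements.
   Context: Define $\varPhi_{B_2}:\mathbf{C}^2\to\mathbf{C}^2$ by $\varPhi_{B_2}(\sigma,\tau)=\bigl(e^{2\pi i\sigma}+e^{-2\pi i\sigma}+e^{2\pi i\tau}+e^{-2\pi i\tau},\ (e^{2\pi i\sigma}+e^{-2\pi i\sigma})(e^{2\pi i\tau}+e^{-2\pi i\tau})\bigr)$. For each integer $k\ge 0$, $\mathcal{B}_k:\mathbf{C}^2\to\mathbf{C}^2$ denotes the unique polynomial map (with integer coefficients) satisfying $\varPhi_{B_2}(k\sigma,k\tau)=\mathcal{B}_k(\varPhi_{B_2}(\sigma,\tau))$ for all $\sigma,\tau\in\mathbf{C}$. *)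

theory Defs
  imports Complex_Main
begin

definition \<Phi>\<^sub>B\<^sub>2 :: "complex \<times> complex \<Rightarrow> complex \<times> complex" where
  "\<Phi>\<^sub>B\<^sub>2 = (\<lambda>(\<sigma>, \<tau>).
     (exp (2 * of_real pi * \<i> * \<sigma>) + exp (- (2 * of_real pi * \<i> * \<sigma>)) +
      exp (2 * of_real pi * \<i> * \<tau>) + exp (- (2 * of_real pi * \<i> * \<tau>)),
      (exp (2 * of_real pi * \<i> * \<sigma>) + exp (- (2 * of_real pi * \<i> * \<sigma>))) *
      (exp (2 * of_real pi * \<i> * \<tau>) + exp (- (2 * of_real pi * \<i> * \<tau>)))))"

definition int_polynomial_fun2 :: "(complex \<times> complex \<Rightarrow> complex) \<Rightarrow> bool" where
  "int_polynomial_fun2 f \<longleftrightarrow>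
     (\<exists>(n::nat) (c :: nat \<Rightarrow> nat \<Rightarrow> int). \<forall>x y.
        f (x, y) = (\<Sum>i\<le>n. \<Sum>j\<le>n. of_int (c i j) * x ^ i * y ^ j))"

definition int_polynomial_map2 :: "(complex \<times> complex \<Rightarrow> complex \<times> complex) \<Rightarrow> bool" where
  "int_polynomial_map2 F \<longleftrightarrow> int_polynomial_fun2 (fst \<circ> F) \<and> int_polynomial_fun2 (snd \<circ> F)"

(* A definite description: any concrete fact about it requires existence and uniqueness
   of the map.  Uniqueness follows from surjectivity of \<Phi>\<^sub>B\<^sub>2. *)
definition \<B> :: "nat \<Rightarrow> complex \<times> complex \<Rightarrow> complex \<times> complex" where
  "\<B> k = (THE F. int_polynomial_map2 F \<and>
           (\<forall>\<sigma> \<tau>. \<Phi>\<^sub>B\<^sub>2 (of_nat k * \<sigma>, of_nat k * \<tau>) = F (\<Phi>\<^sub>B\<^sub>2 (\<sigma>, \<tau>))))"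

definition Fix :: "('a \<Rightarrow> 'a) \<Rightarrow> 'a set" where
  "Fix f = {\<alpha>. f \<alpha> = \<alpha>}"

end

theory Submission
  imports Defs "HOL-Analysis.Complex_Transcendental"
begin

text \<open>
  In the coordinates \<open>(x, y) = (u + v, u * v)\<close> the map \<open>\<B> k\<close> sends the unordered pair
  \<open>{u, v}\<close> to \<open>{C u, C v}\<close>, where \<open>C\<close> is the Chebyshev polynomial with
  \<open>C (z + 1/z) = z^k + 1/z^k\<close>. Hence a pair is fixed iff both entries are fixed by \<open>C\<close>, or \<open>C\<close>
  swaps them. If a set \<open>A \<union> B\<close> carries an involution which preserves \<open>A\<close> and \<open>B\<close> and
  whose fixed points are exactly \<open>A \<inter> B\<close>, then it has \<open>(card A + card B) / 2\<close> orbits.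
  Applied to inversion on the roots of unity of orders \<open>n - 1\<close> and \<open>n + 1\<close>, this shows that the
  \<open>n\<close>-th Chebyshev polynomial has \<open>n\<close> fixed points. Applied to the swap on \<open>F \<times> F\<close>, with \<open>F\<close> the fixed
  points of \<open>C\<close>, and on the graph of \<open>C\<close> over the \<open>k^2\<close> fixed points of \<open>C \<circ> C\<close>, it gives
  the theorem.
\<close>

section \<open>Counting orbits of an involution\<close>

text \<open>The fibres of \<open>f\<close> are the orbits of \<open>i\<close>. A fixed point lies in
  both sets and counts once in each; a two-element orbit lies in exactly one of them and counts
  twice there. So each fibre contributes 2 to \<open>card A + card B\<close>.\<close>

lemma card_image_involution:
  assumes fin: "finite A" "finite B"
    and iA: "\<And>a. a \<in> A \<Longrightarrow> i a \<in> A" and iB: "\<And>b. b \<in> B \<Longrightarrow> i b \<in> B"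
    and fixp: "\<And>a. a \<in> A \<union> B \<Longrightarrow> i a = a \<longleftrightarrow> a \<in> A \<inter> B"
    and inv: "\<And>a. a \<in> A \<union> B \<Longrightarrow> i (i a) = a"
    and fib: "\<And>a b. a \<in> A \<union> B \<Longrightarrow> b \<in> A \<union> B \<Longrightarrow> f b = f a \<longleftrightarrow> b = a \<or> b = i a"
  shows "2 * card (f ` (A \<union> B)) = card A + card B"
proof -
  let ?Y = "f ` (A \<union> B)"
  have finY: "finite ?Y" using fin by auto
  have split: "card S = (\<Sum>y\<in>?Y. card {x \<in> S. f x = y})" if "S \<subseteq> A \<union> B" for S
    using sum.group[of S ?Y f "\<lambda>_. 1::nat"] that fin finite_subset[OF that] image_mono[OF that, of f]
    by auto
  have two: "card {x \<in> A. f x = y} + card {x \<in> B. f x = y} = 2" if "y \<in> ?Y" for y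
  proof -
    from that obtain a where a: "a \<in> A \<union> B" "y = f a" by blast
    have fibre: "{x \<in> S. f x = y} = {x \<in> S. x = a \<or> x = i a}" if "S \<subseteq> A \<union> B" for S
      using that a fib by blast
    show ?thesis
    proof (cases "i a = a")
      case True
      then have "a \<in> A" "a \<in> B" using fixp a by auto
      then have "{x \<in> A. f x = y} = {a}" "{x \<in> B. f x = y} = {a}"
        using fibre[of A] fibre[of B] True by auto
      then show ?thesis by simp
    next
      case False
      then consider "a \<in> A" "a \<notin> B" | "a \<in> B" "a \<notin> A" using fixp a by auto
      then show ?thesis
      proof cases
        case 1
        then have "i a \<in> A" "i a \<notin> B" using iA iB inv[of a] by force+
        then have fibres: "{x \<in> A. f x = y} = {a, i a}" "{x \<in> B. f x = y} = {}"
          using fibre[of A] fibre[of B] 1 by auto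
        show ?thesis unfolding fibres using False by simp
      next
        case 2
        then have "i a \<in> B" "i a \<notin> A" using iA iB inv[of a] by force+
        then have fibres: "{x \<in> B. f x = y} = {a, i a}" "{x \<in> A. f x = y} = {}"
          using fibre[of A] fibre[of B] 2 by auto
        show ?thesis unfolding fibres using False by simp
      qed
    qed
  qed
  have "card A + card B = (\<Sum>y\<in>?Y. card {x \<in> A. f x = y} + card {x \<in> B. f x = y})"
    using split[of A] split[of B] by (simp add: sum.distrib)
  also have "\<dots> = (\<Sum>y\<in>?Y. 2)" using two by (intro sum.cong) auto
  finally show ?thesis by simp
qed

section \<open>Recovering a pair from its sum and product\<close>

text \<open>Both pairs are the roots of the same monic quadratic, which over an integral domain
  determines them up to order.\<close>

lemma sum_prod_eq_iff:
  fixes u v u' v' :: "'a :: idom"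
  shows "u + v = u' + v' \<and> u * v = u' * v' \<longleftrightarrow> u = u' \<and> v = v' \<or> u = v' \<and> v = u'"
proof
  assume h: "u + v = u' + v' \<and> u * v = u' * v'"
  have "(u - u') * (u - v') = u * u - u * (u' + v') + u' * v'" by (simp add: algebra_simps)
  also have "\<dots> = u * u - u * (u + v) + u * v" using h by metis
  also have "\<dots> = 0" by (simp add: algebra_simps)
  finally have "u = u' \<or> u = v'" by auto
  then show "u = u' \<and> v = v' \<or> u = v' \<and> v = u'" using h by (auto simp: add.commute)
qed (auto simp: algebra_simps)

lemma ex_sum_prod:
  fixes x y :: complex
  obtains u v where "x = u + v" "y = u * v"
proof
  let ?r = "csqrt (x\<^sup>2 - 4 * y)"
  show "x = (x + ?r) / 2 + (x - ?r) / 2" by (simp add: field_simps)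
  have "(x + ?r) / 2 * ((x - ?r) / 2) = (x\<^sup>2 - ?r\<^sup>2) / 4"
    by (simp add: field_simps power2_eq_square)
  then show "y = (x + ?r) / 2 * ((x - ?r) / 2)" by simp
qed

lemma ex_add_inverse:
  fixes u :: complex
  obtains z where "z \<noteq> 0" "u = z + inverse z"
proof -
  \<comment> \<open>\<open>z\<close> and its inverse are found as the roots of
    \<open>t^2 - u * t + 1\<close>.\<close>
  obtain z w where zw: "u = z + w" "1 = z * w" using ex_sum_prod[of u 1] by blast
  then have "z \<noteq> 0" by auto
  moreover from zw have "w = inverse z" by (metis inverse_unique)
  ultimately show ?thesis using that zw by blast
qed

section \<open>Chebyshev polynomials\<close>

text \<open>Normalised so that \<open>cheb n (2 * cos t) = 2 * cos (n * t)\<close>.\<close>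

fun cheb :: "nat \<Rightarrow> 'a :: comm_ring_1 \<Rightarrow> 'a" where
  "cheb 0 u = 2"
| "cheb (Suc 0) u = u"
| "cheb (Suc (Suc n)) u = u * cheb (Suc n) u - cheb n u"

lemma cheb_add_inverse:
  fixes z :: "'a :: field"
  assumes "z \<noteq> 0"
  shows "cheb n (z + inverse z) = z ^ n + inverse z ^ n"
  using assms by (induction n rule: induct_nat_012) (simp_all add: field_simps)

text \<open>In the coordinate \<open>z\<close> with \<open>u = z + inverse z\<close>,
  \<open>cheb n\<close> is the \<open>n\<close>-th power map, so composition multiplies the
  indices.\<close>

lemma cheb_cheb: "cheb m (cheb n u) = cheb (m * n) (u :: complex)"
proof -
  obtain z where z: "z \<noteq> 0" "u = z + inverse z" using ex_add_inverse by blast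
  have "cheb m (cheb n u) = cheb m (z ^ n + inverse (z ^ n))"
    using z by (simp add: cheb_add_inverse power_inverse)
  also have "\<dots> = (z ^ n) ^ m + inverse (z ^ n) ^ m"
    using z by (intro cheb_add_inverse) auto
  also have "\<dots> = cheb (m * n) u"
    using z by (simp add: cheb_add_inverse power_inverse mult.commute flip: power_mult)
  finally show ?thesis .
qed

lemma cheb_fixpoints_eq:
  assumes "n \<ge> 2"
  shows "{u :: complex. cheb n u = u} =
    (\<lambda>z. z + inverse z) ` ({z. z ^ (n - 1) = 1} \<union> {z. z ^ (n + 1) = 1})"
proof -
  have *: "cheb n (z + inverse z) = z + inverse z \<longleftrightarrow> z ^ (n - 1) = 1 \<or> z ^ (n + 1) = 1"
    if z: "z \<noteq> 0" for z :: complex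
  proof -
    \<comment> \<open>The second conjunct is free, both products being 1; it gives the equation the
      form of \<open>sum_prod_eq_iff\<close>.\<close>
    have "cheb n (z + inverse z) = z + inverse z \<longleftrightarrow>
        z ^ n + inverse z ^ n = z + inverse z \<and> z ^ n * inverse z ^ n = z * inverse z"
      using z by (simp add: cheb_add_inverse power_inverse)
    also have "\<dots> \<longleftrightarrow> z ^ n = z \<or> z ^ n = inverse z"
      unfolding sum_prod_eq_iff using z by (auto simp: power_inverse)
    also have "z ^ n = z \<longleftrightarrow> z ^ (n - 1) = 1"
      using z assms by (cases n) auto
    also have "z ^ n = inverse z \<longleftrightarrow> z ^ (n + 1) = 1"
      using z by (auto simp: field_simps)
    finally show ?thesis .
  qed
  have nz: "z \<noteq> 0" if "z ^ (n - 1) = 1 \<or> z ^ (n + 1) = 1" for z :: complex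
    using that assms by (auto simp: power_0_left split: if_splits)
  show ?thesis
  proof (intro equalityI subsetI)
    fix u :: complex assume u: "u \<in> {u. cheb n u = u}"
    obtain z where "z \<noteq> 0" "u = z + inverse z" using ex_add_inverse by blast
    with u *[of z] show "u \<in> (\<lambda>z. z + inverse z) `
      ({z. z ^ (n - 1) = 1} \<union> {z. z ^ (n + 1) = 1})" by auto
  next
    fix u :: complex assume "u \<in> (\<lambda>z. z + inverse z) `
      ({z. z ^ (n - 1) = 1} \<union> {z. z ^ (n + 1) = 1})"
    then obtain z where "u = z + inverse z" "z ^ (n - 1) = 1 \<or> z ^ (n + 1) = 1" by auto
    with nz[of z] *[of z] show "u \<in> {u. cheb n u = u}" by auto
  qed
qed

lemma cheb_fixpoints:
  assumes "n \<ge> 2"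
  shows "finite {u :: complex. cheb n u = u}" "card {u :: complex. cheb n u = u} = n"
proof -
  define A where "A = {z :: complex. z ^ (n - 1) = 1}"
  define B where "B = {z :: complex. z ^ (n + 1) = 1}"
  have nz: "z \<noteq> 0" if "z \<in> A \<union> B" for z
    using that assms by (auto simp: A_def B_def power_0_left split: if_splits)
  have eq: "{u :: complex. cheb n u = u} = (\<lambda>z. z + inverse z) ` (A \<union> B)"
    using cheb_fixpoints_eq[OF assms] by (simp add: A_def B_def)
  have cards: "card A = n - 1" "card B = n + 1"
    using card_roots_unity_eq[of "n - 1"] card_roots_unity_eq[of "n + 1"] assms
    by (auto simp: A_def B_def)
  have fin: "finite A" "finite B"
    using finite_roots_unity[of "n - 1"] finite_roots_unity[of "n + 1"] assms
    by (auto simp: A_def B_def)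
  have inv: "z \<in> A \<Longrightarrow> inverse z \<in> A" "z \<in> B \<Longrightarrow> inverse z \<in> B" for z
    unfolding A_def B_def mem_Collect_eq power_inverse by simp_all
  \<comment> \<open>The exponents differ by 2, so an element of \<open>A \<union> B\<close> lies in
    both sets exactly when \<open>z\<^sup>2 = 1\<close>, that is, when inversion fixes it.\<close>
  have pow: "z ^ (n + 1) = z ^ (n - 1) * z\<^sup>2" for z :: complex
    using assms by (simp flip: power_add)
  have "2 * card ((\<lambda>z. z + inverse z) ` (A \<union> B)) = card A + card B"
  proof (rule card_image_involution[where i = inverse])
    fix z assume z: "z \<in> A \<union> B"
    have "inverse z = z \<longleftrightarrow> z\<^sup>2 = 1"
      using nz[OF z] by (auto simp: field_simps power2_eq_square)
    also have "\<dots> \<longleftrightarrow> z \<in> A \<inter> B"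
      using z pow[of z] by (auto simp: A_def B_def)
    finally show "inverse z = z \<longleftrightarrow> z \<in> A \<inter> B" .
  next
    fix a b assume "a \<in> A \<union> B" "b \<in> A \<union> B"
    then have "a \<noteq> 0" "b \<noteq> 0" using nz by auto
    then show "b + inverse b = a + inverse a \<longleftrightarrow> b = a \<or> b = inverse a"
      using sum_prod_eq_iff[of b "inverse b" a "inverse a"] by auto
  qed (use fin inv in auto)
  then show "card {u :: complex. cheb n u = u} = n"
    using eq cards assms by simp
  show "finite {u :: complex. cheb n u = u}"
    using eq fin by simp
qed

section \<open>Integer polynomial functions in two variables\<close>

lemma int_polynomial_fun2_monom:
  "int_polynomial_fun2 (\<lambda>(x, y). of_int c * x ^ i * y ^ j)"
proof -
  have "of_int c * x ^ i * y ^ j = (\<Sum>i'\<le>i + j. \<Sum>j'\<le>i + j.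
      of_int (if i' = i then if j' = j then c else 0 else 0) * x ^ i' * y ^ j')" for x y :: complex
  proof -
    have "(\<Sum>j'\<le>i + j. of_int (if i' = i then if j' = j then c else 0 else 0) * x ^ i' * y ^ j')
        = (if i' = i then of_int c * x ^ i * y ^ j else 0)" for i'
      by (simp add: if_distrib[of of_int] if_distrib[of "\<lambda>t. t * _"] cong: if_cong)
    then show ?thesis by simp
  qed
  then show ?thesis unfolding int_polynomial_fun2_def
    by (intro exI[of _ "i + j"] exI[of _ "\<lambda>i' j'. if i' = i then if j' = j then c else 0 else 0"])
      auto
qed

lemma int_polynomial_fun2_of_int: "int_polynomial_fun2 (\<lambda>p. of_int c)"
  using int_polynomial_fun2_monom[of c 0 0] by (simp add: case_prod_unfold)

lemma int_polynomial_fun2_fst: "int_polynomial_fun2 fst"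
  using int_polynomial_fun2_monom[of 1 1 0] by (simp add: case_prod_unfold)

lemma int_polynomial_fun2_snd: "int_polynomial_fun2 snd"
  using int_polynomial_fun2_monom[of 1 0 1] by (simp add: case_prod_unfold)

lemma int_polynomial_fun2_add:
  assumes "int_polynomial_fun2 f" "int_polynomial_fun2 g"
  shows "int_polynomial_fun2 (\<lambda>p. f p + g p)"
proof -
  obtain n c where f: "\<And>x y. f (x, y) = (\<Sum>i\<le>n. \<Sum>j\<le>n. of_int (c i j) * x ^ i * y ^ j)"
    using assms(1) unfolding int_polynomial_fun2_def by blast
  obtain m d where g: "\<And>x y. g (x, y) = (\<Sum>i\<le>m. \<Sum>j\<le>m. of_int (d i j) * x ^ i * y ^ j)"
    using assms(2) unfolding int_polynomial_fun2_def by blast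
  define N where "N = max n m"
  \<comment> \<open>Coefficients beyond the bound \<open>r\<close> are arbitrary, so they are cut
    off before both arrays are added on a common square.\<close>
  define pad where "pad r e = (\<lambda>i j. if i \<le> r \<and> j \<le> r then e i j else 0 :: int)"
    for r :: nat and e
  have padded: "(\<Sum>i\<le>r. \<Sum>j\<le>r. of_int (e i j) * x ^ i * y ^ j)
      = (\<Sum>i\<le>N. \<Sum>j\<le>N. of_int (pad r e i j) * x ^ i * y ^ j)"
    if "r \<le> N" for r e and x y :: complex
    using that unfolding pad_def
    by (intro sum.mono_neutral_cong_left) (auto intro!: sum.mono_neutral_cong_left)
  have "f (x, y) + g (x, y)
      = (\<Sum>i\<le>N. \<Sum>j\<le>N. of_int (pad n c i j + pad m d i j) * x ^ i * y ^ j)" for x y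
    using padded[of n c x y] padded[of m d x y]
    by (simp add: f g N_def sum.distrib ring_distribs)
  then show ?thesis unfolding int_polynomial_fun2_def
    by (intro exI[of _ N] exI[of _ "\<lambda>i j. pad n c i j + pad m d i j"]) auto
qed

lemma int_polynomial_fun2_sum:
  assumes "finite S" "\<And>s. s \<in> S \<Longrightarrow> int_polynomial_fun2 (f s)"
  shows "int_polynomial_fun2 (\<lambda>p. \<Sum>s\<in>S. f s p)"
  using assms
proof (induction S rule: finite_induct)
  case empty
  show ?case using int_polynomial_fun2_of_int[of 0] by simp
next
  case (insert s S)
  then show ?case using int_polynomial_fun2_add by simp
qed

text \<open>The product expands into a finite sum of monomials, so closure under sums suffices and
  no convolution of coefficients is formed.\<close>

lemma int_polynomial_fun2_mult:
  assumes "int_polynomial_fun2 f" "int_polynomial_fun2 g"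
  shows "int_polynomial_fun2 (\<lambda>p. f p * g p)"
proof -
  obtain n c where f: "\<And>x y. f (x, y) = (\<Sum>i\<le>n. \<Sum>j\<le>n. of_int (c i j) * x ^ i * y ^ j)"
    using assms(1) unfolding int_polynomial_fun2_def by blast
  obtain m d where g: "\<And>x y. g (x, y) = (\<Sum>i\<le>m. \<Sum>j\<le>m. of_int (d i j) * x ^ i * y ^ j)"
    using assms(2) unfolding int_polynomial_fun2_def by blast
  have "(\<lambda>p. f p * g p) = (\<lambda>p. \<Sum>i\<le>n. \<Sum>j\<le>n. \<Sum>i'\<le>m. \<Sum>j'\<le>m.
      (case p of (x, y) \<Rightarrow> of_int (c i j * d i' j') * x ^ (i + i') * y ^ (j + j')))"
    unfolding fun_eq_iff split_paired_All f g sum_distrib_right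
    unfolding sum_distrib_left by (simp add: power_add mult_ac)
  then show ?thesis
    by (simp only:) (intro int_polynomial_fun2_sum int_polynomial_fun2_monom finite_atMost)
qed

lemma int_polynomial_fun2_diff:
  assumes "int_polynomial_fun2 f" "int_polynomial_fun2 g"
  shows "int_polynomial_fun2 (\<lambda>p. f p - g p)"
  using int_polynomial_fun2_add[OF assms(1)
      int_polynomial_fun2_mult[OF int_polynomial_fun2_of_int[of "-1"] assms(2)]]
  by simp

lemmas int_polynomial_fun2_intros =
  int_polynomial_fun2_of_int int_polynomial_fun2_fst int_polynomial_fun2_snd
  int_polynomial_fun2_add int_polynomial_fun2_mult int_polynomial_fun2_diff

section \<open>The map on unordered pairs\<close>

text \<open>
  Since \<open>u^2 = x * u - y\<close> for \<open>x = u + v\<close> and \<open>y = u * v\<close>, the value \<open>cheb n u\<close> reduces to the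
  linear form \<open>a + b * u\<close> with coefficients in the integer polynomials in \<open>x\<close> and \<open>y\<close>, and by
  symmetry the same coefficients serve \<open>v\<close>.
\<close>

fun cheb_coeffs :: "nat \<Rightarrow> complex \<times> complex \<Rightarrow> complex \<times> complex" where
  "cheb_coeffs 0 p = (2, 0)"
| "cheb_coeffs (Suc 0) p = (0, 1)"
| "cheb_coeffs (Suc (Suc n)) p =
    (0 - snd p * snd (cheb_coeffs (Suc n) p) - fst (cheb_coeffs n p),
     fst (cheb_coeffs (Suc n) p) + fst p * snd (cheb_coeffs (Suc n) p) - snd (cheb_coeffs n p))"

lemma int_polynomial_cheb_coeffs:
  "int_polynomial_fun2 (\<lambda>p. fst (cheb_coeffs n p)) \<and> int_polynomial_fun2 (\<lambda>p. snd (cheb_coeffs n p))"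
proof (induction n rule: induct_nat_012)
  case 0
  show ?case using int_polynomial_fun2_of_int[of 2] int_polynomial_fun2_of_int[of 0] by simp
next
  case 1
  show ?case using int_polynomial_fun2_of_int[of 0] int_polynomial_fun2_of_int[of 1] by simp
next
  case (ge2 n)
  then show ?case
    using int_polynomial_fun2_of_int[of 0]
    by (auto intro!: int_polynomial_fun2_intros simp del: diff_0)
qed

text \<open>With \<open>x = u + v\<close> and \<open>y = u * v\<close>, multiplying
  \<open>a + b * u\<close> by \<open>u\<close> gives \<open>- y * b + (a + x * b) * u\<close>, which
  is the recursion of \<open>cheb_coeffs\<close>.\<close>

lemma cheb_eq_coeffs:
  "cheb n u = fst (cheb_coeffs n (u + v, u * v)) + snd (cheb_coeffs n (u + v, u * v)) * u"
  by (induction n rule: induct_nat_012) (simp_all add: algebra_simps)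

text \<open>The components are the sum and the product of \<open>a + b * u\<close> and
  \<open>a + b * v\<close>, rewritten in \<open>u + v\<close> and \<open>u * v\<close>.\<close>

definition cheb_pair :: "nat \<Rightarrow> complex \<times> complex \<Rightarrow> complex \<times> complex" where
  "cheb_pair n p = (let (a, b) = cheb_coeffs n p
     in (2 * a + b * fst p, a * a + a * b * fst p + b * b * snd p))"

lemma cheb_pair_eq: "cheb_pair n (u + v, u * v) = (cheb n u + cheb n v, cheb n u * cheb n v)"
proof -
  obtain a b where ab: "cheb_coeffs n (u + v, u * v) = (a, b)" by fastforce
  have u: "cheb n u = a + b * u" using cheb_eq_coeffs[of n u v] ab by simp
  have v: "cheb n v = a + b * v"
    using cheb_eq_coeffs[of n v u] ab by (simp add: add.commute mult.commute)
  show ?thesis unfolding cheb_pair_def ab u v by (simp add: algebra_simps)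
qed

lemma int_polynomial_map2_cheb_pair: "int_polynomial_map2 (cheb_pair n)"
proof -
  have "int_polynomial_fun2 (\<lambda>p. of_int 2 * fst (cheb_coeffs n p) + snd (cheb_coeffs n p) * fst p)"
    "int_polynomial_fun2 (\<lambda>p. fst (cheb_coeffs n p) * fst (cheb_coeffs n p)
       + fst (cheb_coeffs n p) * snd (cheb_coeffs n p) * fst p
       + snd (cheb_coeffs n p) * snd (cheb_coeffs n p) * snd p)"
    using int_polynomial_cheb_coeffs[of n]
    by (auto intro!: int_polynomial_fun2_intros simp del: of_int_numeral)
  then show ?thesis
    by (simp add: int_polynomial_map2_def cheb_pair_def o_def case_prod_unfold Let_def)
qed

section \<open>Exponential parametrisation and identification of \<open>\<B> k\<close>\<close>

definition two_cos :: "complex \<Rightarrow> complex" where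
  "two_cos \<sigma> = exp (2 * of_real pi * \<i> * \<sigma>) + exp (- (2 * of_real pi * \<i> * \<sigma>))"

lemma Phi_eq: "\<Phi>\<^sub>B\<^sub>2 (\<sigma>, \<tau>) = (two_cos \<sigma> + two_cos \<tau>, two_cos \<sigma> * two_cos \<tau>)"
  by (simp add: \<Phi>\<^sub>B\<^sub>2_def two_cos_def)

lemma two_cos_mult: "two_cos (of_nat k * \<sigma>) = cheb k (two_cos \<sigma>)"
proof -
  define z where "z = exp (2 * of_real pi * \<i> * \<sigma>)"
  have "exp (2 * of_real pi * \<i> * (of_nat k * \<sigma>)) = z ^ k"
    unfolding z_def exp_of_nat_mult[symmetric] by (simp add: mult_ac)
  then show ?thesis
    using cheb_add_inverse[of z k] by (simp add: two_cos_def z_def exp_minus power_inverse)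
qed

lemma surj_two_cos: "surj two_cos"
proof -
  have "\<exists>\<sigma>. u = two_cos \<sigma>" for u
  proof -
    obtain z where z: "z \<noteq> 0" "u = z + inverse z" by (rule ex_add_inverse)
    \<comment> \<open>A nonzero \<open>z\<close> is an exponential; dividing \<open>Ln z\<close> by
      the period factor gives the argument.\<close>
    then have "u = two_cos (Ln z / (2 * of_real pi * \<i>))"
      by (simp add: two_cos_def exp_minus)
    then show ?thesis ..
  qed
  then show ?thesis by (auto simp: surj_def)
qed

lemma surj_Phi: "surj \<Phi>\<^sub>B\<^sub>2"
proof -
  have "\<exists>q. p = \<Phi>\<^sub>B\<^sub>2 q" for p
  proof -
    obtain u v where "fst p = u + v" "snd p = u * v" by (rule ex_sum_prod)
    moreover obtain \<sigma> \<tau> where "u = two_cos \<sigma>" "v = two_cos \<tau>"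
      using surj_two_cos by (meson surjD)
    ultimately have "p = \<Phi>\<^sub>B\<^sub>2 (\<sigma>, \<tau>)" by (simp add: Phi_eq prod_eq_iff)
    then show ?thesis ..
  qed
  then show ?thesis by (auto simp: surj_def)
qed

text \<open>This resolves the definite description. As \<open>\<Phi>\<^sub>B\<^sub>2\<close> is
  surjective, the functional equation prescribes the value at every point, hence uniqueness.\<close>

lemma B_eq_cheb_pair: "\<B> k = cheb_pair k"
  unfolding \<B>_def
proof (rule the_equality)
  have comm: "\<Phi>\<^sub>B\<^sub>2 (of_nat k * \<sigma>, of_nat k * \<tau>) = cheb_pair k (\<Phi>\<^sub>B\<^sub>2 (\<sigma>, \<tau>))" for \<sigma> \<tau>
    by (simp add: Phi_eq two_cos_mult cheb_pair_eq)
  then show "int_polynomial_map2 (cheb_pair k) \<and>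
      (\<forall>\<sigma> \<tau>. \<Phi>\<^sub>B\<^sub>2 (of_nat k * \<sigma>, of_nat k * \<tau>) = cheb_pair k (\<Phi>\<^sub>B\<^sub>2 (\<sigma>, \<tau>)))"
    using int_polynomial_map2_cheb_pair by blast
  fix F assume F: "int_polynomial_map2 F \<and>
      (\<forall>\<sigma> \<tau>. \<Phi>\<^sub>B\<^sub>2 (of_nat k * \<sigma>, of_nat k * \<tau>) = F (\<Phi>\<^sub>B\<^sub>2 (\<sigma>, \<tau>)))"
  show "F = cheb_pair k"
  proof
    fix p
    obtain \<sigma> \<tau> where "p = \<Phi>\<^sub>B\<^sub>2 (\<sigma>, \<tau>)" using surj_Phi by (metis surjD surj_pair)
    then show "F p = cheb_pair k p" using F comm by metis
  qed
qed

theorem theorem2p3: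
  fixes k :: nat
  assumes "k \<ge> 2"
  shows "finite (Fix (\<B> k)) \<and> card (Fix (\<B> k)) = k ^ 2"
proof -
  define F where "F = {u :: complex. cheb k u = u}"
  define G where "G = {u :: complex. cheb (k * k) u = u}"
  define A where "A = F \<times> F"
  define B where "B = (\<lambda>u. (u, cheb k u)) ` G"
  define f where "f = (\<lambda>(u, v). (u + v, u * v :: complex))"
  have k2: "k * k \<ge> 2" using assms mult_le_mono[of 1 k 2 k] by simp
  have F: "finite F" "card F = k" using cheb_fixpoints[OF assms] by (auto simp: F_def)
  have G: "finite G" "card G = k * k" using cheb_fixpoints[OF k2] by (auto simp: G_def)
  \<comment> \<open>\<open>B\<close> consists of the pairs whose entries are swapped by
    \<open>cheb k\<close>, since \<open>cheb (k * k)\<close> is \<open>cheb k\<close> composed with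
    itself.\<close>
  have memB: "(u, v) \<in> B \<longleftrightarrow> v = cheb k u \<and> u = cheb k v" for u v
    unfolding B_def G_def cheb_cheb[symmetric] by auto
  have cards: "card A = k * k" "card B = k * k"
    using F G by (auto simp: A_def B_def card_cartesian_product card_image inj_on_def)
  have fin: "finite A" "finite B" using F G by (auto simp: A_def B_def)
  \<comment> \<open>Equal sum and product leave two cases: both entries are fixed (\<open>A\<close>)
    or they are swapped (\<open>B\<close>).\<close>
  have "\<B> k (f (u, v)) = f (u, v) \<longleftrightarrow> (u, v) \<in> A \<union> B" for u v
    using sum_prod_eq_iff[of "cheb k u" "cheb k v" u v]
    by (auto simp: f_def B_eq_cheb_pair cheb_pair_eq memB A_def F_def)
  then have fixed: "\<B> k (f q) = f q \<longleftrightarrow> q \<in> A \<union> B" for q by (cases q) simp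
  have surj: "\<exists>q. p = f q" for p
  proof -
    obtain u v where "fst p = u + v" "snd p = u * v" by (rule ex_sum_prod)
    then have "p = f (u, v)" by (simp add: f_def prod_eq_iff)
    then show ?thesis ..
  qed
  have eq: "Fix (\<B> k) = f ` (A \<union> B)"
  proof (intro equalityI subsetI)
    fix p assume p: "p \<in> Fix (\<B> k)"
    obtain q where "p = f q" using surj by blast
    with p fixed[of q] show "p \<in> f ` (A \<union> B)" by (simp add: Fix_def)
  next
    fix p assume "p \<in> f ` (A \<union> B)"
    then obtain q where "q \<in> A \<union> B" "p = f q" by blast
    with fixed[of q] show "p \<in> Fix (\<B> k)" by (simp add: Fix_def)
  qed
  have "2 * card (f ` (A \<union> B)) = card A + card B"
  proof (rule card_image_involution[where i = prod.swap])
    fix p q :: "complex \<times> complex"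
    show "f q = f p \<longleftrightarrow> q = p \<or> q = prod.swap p"
      using sum_prod_eq_iff[of "fst q" "snd q" "fst p" "snd p"]
      by (auto simp: f_def case_prod_unfold prod_eq_iff)
  next
    \<comment> \<open>\<open>A \<inter> B\<close> is the set of pairs \<open>(u, u)\<close> with
      \<open>cheb k u = u\<close>, the diagonal part of either set.\<close>
    fix p :: "complex \<times> complex" assume "p \<in> A \<union> B"
    then show "prod.swap p = p \<longleftrightarrow> p \<in> A \<inter> B"
      by (cases p) (auto simp: A_def F_def memB dest: sym)
  next
    fix p :: "complex \<times> complex" assume "p \<in> B"
    then show "prod.swap p \<in> B" using memB by (metis prod.collapse swap_simp)
  qed (use fin in \<open>auto simp: A_def\<close>)
  then show ?thesis using eq cards fin by (simp add: power2_eq_square)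
qed

end
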